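(* Let $f:\mathbb{R}^{n\times p}\to\mathbb{R}$ be locally Lipschitz continuous. Let $\beta>0$ and $r\in\left(0,\frac{\beta}{2\beta+16M_1}\right)$. If $X^*\in\Omega_r$ is a local minimizer of $h$ over $\mathbb{R}^{n\times p}$, then $X^*$ is a local minimizer of the problem $\min\{f(X):X\in\mathbb{R}^{n\times p},\ X^\top X=I_p\}$ (in particular $X^*$ is feasible). Moreover, any local minimizer $X^*$ of $\min\{f(X):X\in\mathbb{R}^{n\times p},\ X^\top X=I_p\}$ is a local minimizer of $h$ over $\mathbb{R}^{n\times p}$.
   Context: $\|\cdot\|_{\mathrm F}$ is the Frobenius norm and $\partial$ denotes the Clarke subdifferential. For $r>0$, $\Omega_r=\{X\in\mathbb{R}^{n\times p}:\|X^\top X-I_p\|_{\mathrm F}\le r\}$. $\mathcal{A}(X)=\frac18X\left(15I_p-10X^\top X+3(X^\top X)^2\right)$ for $X\in\mathbb{R}^{n\times p}$, and for a penalty parameter $\beta>0$, $h(X)=f(\mathcal{A}(X))+\frac{\beta}{4}\|X^\top X-I_p\|_{\mathrm F}^2$. $M_1=\sup\{\|W\|_{\mathrm F}:X\in\Omega_1,\ W\in\partial f(X)\}$. A local minimizer of the constrained problem is a point $X^*$ with $X^{*\top}X^*=I_p$ such that $f(Z)\ge f(X^* )$ for all $Z$ with $Z^\top Z=I_p$ sufficiently close to $X^*$. *)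

theory Defs
  imports "HOL-Analysis.Analysis"
begin

definition locally_lipschitz :: "('a::metric_space \<Rightarrow> 'b::metric_space) \<Rightarrow> bool" where
  "locally_lipschitz f \<longleftrightarrow> (\<forall>x. \<exists>e>0. \<exists>L. L-lipschitz_on (ball x e) f)"

definition local_minimizer_on :: "('a::metric_space \<Rightarrow> real) \<Rightarrow> 'a set \<Rightarrow> 'a \<Rightarrow> bool" where
  "local_minimizer_on f S x \<longleftrightarrow> x \<in> S \<and> (\<exists>e>0. \<forall>z\<in>S. dist z x < e \<longrightarrow> f x \<le> f z)"

text \<open>The generalized directional derivative is the upper limit of \<open>(f (y + t d) - f y) / t\<close>
  as \<open>y\<close> tends to \<open>x\<close> (with \<open>y = x\<close> allowed) and \<open>t\<close> decreases to 0.  It is valued in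
  \<open>ereal\<close> so that the upper limit always exists; it is finite for locally Lipschitz \<open>f\<close>.\<close>

definition clarke_dir_deriv :: "('a::real_inner \<Rightarrow> real) \<Rightarrow> 'a \<Rightarrow> 'a \<Rightarrow> ereal" where
  "clarke_dir_deriv f x d =
     Limsup (nhds x \<times>\<^sub>F at_right 0) (\<lambda>(y, t::real). ereal ((f (y + t *\<^sub>R d) - f y) / t))"

definition clarke_subdifferential :: "('a::real_inner \<Rightarrow> real) \<Rightarrow> 'a \<Rightarrow> 'a set" where
  "clarke_subdifferential f x = {w. \<forall>d. ereal (w \<bullet> d) \<le> clarke_dir_deriv f x d}"

text \<open>An \<open>n\<close> by \<open>p\<close> matrix has type \<open>real ^ 'p ^ 'n\<close>.  The library norm and inner product of this
  type are the Frobenius ones:\<close>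

lemma norm_matrix_eq_frobenius:
  fixes X :: "real ^ 'p ^ 'n"
  shows "norm X = sqrt (\<Sum>i\<in>UNIV. \<Sum>j\<in>UNIV. (X $ i $ j)\<^sup>2)"
  by (simp add: norm_vec_def L2_set_def sum_nonneg)

lemma inner_matrix_eq_frobenius:
  fixes X Y :: "real ^ 'p ^ 'n"
  shows "X \<bullet> Y = (\<Sum>i\<in>UNIV. \<Sum>j\<in>UNIV. X $ i $ j * Y $ i $ j)"
  by (simp add: inner_vec_def)

definition stiefel :: "(real ^ 'p ^ 'n) set" where
  "stiefel = {X. transpose X ** X = mat 1}"

definition Omega :: "real \<Rightarrow> (real ^ 'p ^ 'n) set" where
  "Omega r = {X. norm (transpose X ** X - mat 1) \<le> r}"

definition dissolve :: "real ^ 'p ^ 'n \<Rightarrow> real ^ 'p ^ 'n" where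
  "dissolve X = (1 / 8) *\<^sub>R
     (X ** (15 *\<^sub>R mat 1 - 10 *\<^sub>R (transpose X ** X)
            + 3 *\<^sub>R ((transpose X ** X) ** (transpose X ** X))))"

definition penalty_fun :: "(real ^ 'p ^ 'n \<Rightarrow> real) \<Rightarrow> real \<Rightarrow> real ^ 'p ^ 'n \<Rightarrow> real" where
  "penalty_fun f \<beta> X = f (dissolve X) + \<beta> / 4 * (norm (transpose X ** X - mat 1))\<^sup>2"

text \<open>The supremum is taken in \<open>[0, \<infinity>]\<close>, so that it is 0 in the degenerate case \<open>Omega 1 = {}\<close>
  (possible only for \<open>p > n\<close>, where \<open>stiefel\<close> is empty too), whereas the supremum of the empty
  set of reals is unspecified.  It is finite for locally Lipschitz \<open>f\<close>.\<close>

definition M1 :: "(real ^ 'p ^ 'n \<Rightarrow> real) \<Rightarrow> ennreal" where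
  "M1 f = Sup {ennreal (norm W) | X W. X \<in> Omega 1 \<and> W \<in> clarke_subdifferential f X}"

end

theory Submission
  imports Defs
begin

text \<open>
  Write \<open>D = X\<^sup>T X - I\<close>.  Then \<open>dissolve X = X (I - D/2 + 3/8 D\<^sup>2)\<close>, the second order expansion of the
  polar projection \<open>X (X\<^sup>T X)\<^bsup>-1/2\<^esup>\<close>, so the defect of \<open>dissolve X\<close> is cubic in \<open>D\<close>.

  For the first claim move along the curve \<open>X (I - t D)\<close>: at \<open>t = 0\<close> the penalty decreases at rate
  \<open>\<beta> \<langle>D, D + D\<^sup>2\<rangle>\<close>, of order \<open>\<parallel>D\<parallel>\<^sup>2\<close>, whereas \<open>dissolve\<close> moves only with velocity \<open>- 15/8 X D\<^sup>3\<close>.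
  Near \<open>dissolve X\<close> the function \<open>f\<close> is Lipschitz with constant \<open>M\<^sub>1\<close>, because the generalized
  directional derivative is the support function of the Clarke subdifferential.  The bound on \<open>r\<close>
  then makes the curve a descent direction unless \<open>D = 0\<close>.

  For the second claim, a point \<open>Z\<close> near a constrained minimizer has a point of the Stiefel manifold
  within \<open>O(\<parallel>D\<parallel>\<^sup>3)\<close> of \<open>dissolve Z\<close>, so \<open>f (dissolve Z)\<close> loses at most \<open>O(\<parallel>D\<parallel>\<^sup>3)\<close> against the
  minimum, which the penalty \<open>\<beta>/4 \<parallel>D\<parallel>\<^sup>2\<close> outweighs.
\<close>

subsection \<open>The Clarke subdifferential and Lipschitz constants\<close>

lemma eventually_nhds_prod_at_right:
  fixes x :: "'a::metric_space"
  shows "eventually P (nhds x \<times>\<^sub>F at_right (0::real)) \<longleftrightarrow>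
    (\<exists>\<delta>>0. \<forall>y t. dist y x < \<delta> \<longrightarrow> 0 < t \<longrightarrow> t < \<delta> \<longrightarrow> P (y, t))" (is "?L \<longleftrightarrow> ?R")
proof
  assume ?L
  then obtain A B where A: "eventually A (nhds x)" and B: "eventually B (at_right (0::real))"
    and P: "\<And>y t. A y \<Longrightarrow> B t \<Longrightarrow> P (y, t)"
    unfolding eventually_prod_filter by blast
  from A obtain a where a: "a > 0" "\<And>y. dist y x < a \<Longrightarrow> A y"
    by (auto simp: eventually_nhds_metric)
  from B obtain b where b: "b > 0" "\<And>t. 0 < t \<Longrightarrow> t < b \<Longrightarrow> B t"
    by (auto simp: eventually_at_right_field)
  show ?R
    using a b P by (intro exI[of _ "min a b"]) auto
next
  assume ?R
  then obtain \<delta> where "\<delta> > 0" and P: "\<And>y t. dist y x < \<delta> \<Longrightarrow> 0 < t \<Longrightarrow> t < \<delta> \<Longrightarrow> P (y, t)"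
    by blast
  have "eventually (\<lambda>y. dist y x < \<delta>) (nhds x)"
    using \<open>\<delta> > 0\<close> by (auto simp: eventually_nhds_metric)
  moreover have "eventually (\<lambda>t::real. 0 < t \<and> t < \<delta>) (at_right 0)"
    using \<open>\<delta> > 0\<close> by (auto simp: eventually_at_right_field)
  ultimately show ?L
    unfolding eventually_prod_filter using P by blast
qed

text \<open>Trades the extended-real upper limit for a real epsilon-delta statement with the
  division by \<open>t\<close> cleared. Sublinearity and the Lipschitz estimate below argue from
  this form.\<close>

lemma clarke_dir_deriv_le_iff:
  "clarke_dir_deriv f x d \<le> ereal c \<longleftrightarrow>
    (\<forall>\<epsilon>>0. \<exists>\<delta>>0. \<forall>y t. dist y x < \<delta> \<longrightarrow> 0 < t \<longrightarrow> t < \<delta> \<longrightarrow>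
      f (y + t *\<^sub>R d) - f y < t * (c + \<epsilon>))" (is "_ \<longleftrightarrow> ?R")
proof -
  let ?F = "nhds x \<times>\<^sub>F at_right (0::real)"
  let ?q = "\<lambda>(y, t::real). ereal ((f (y + t *\<^sub>R d) - f y) / t)"
  have "clarke_dir_deriv f x d \<le> ereal c \<longleftrightarrow> (\<forall>z>ereal c. eventually (\<lambda>u. ?q u < z) ?F)"
    unfolding clarke_dir_deriv_def by (rule Limsup_le_iff)
  also have "\<dots> \<longleftrightarrow> (\<forall>\<epsilon>>0. eventually (\<lambda>u. ?q u < ereal (c + \<epsilon>)) ?F)"
  proof (intro iffI allI impI)
    fix z assume H: "\<forall>\<epsilon>>0. eventually (\<lambda>u. ?q u < ereal (c + \<epsilon>)) ?F" and "ereal c < z"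
    then obtain w where w: "c < w" "ereal w < z"
      by (metis ereal_dense2 less_ereal.simps(1))
    have "eventually (\<lambda>u. ?q u < ereal (c + (w - c))) ?F"
      using w by (intro H[rule_format]) simp
    then show "eventually (\<lambda>u. ?q u < z) ?F"
      by (rule eventually_mono) (use w in \<open>auto intro: less_trans\<close>)
  qed auto
  also have "\<dots> \<longleftrightarrow> ?R"
    unfolding eventually_nhds_prod_at_right by (simp add: pos_divide_less_eq mult.commute)
  finally show ?thesis .
qed

section \<open>Sublinearity and finiteness of the generalized directional derivative\<close>

lemma clarke_dir_deriv_0: "clarke_dir_deriv f x 0 = 0"
proof -
  have "nhds x \<times>\<^sub>F at_right (0::real) \<noteq> bot"
    by (simp add: prod_filter_eq_bot)
  then show ?thesis
    unfolding clarke_dir_deriv_def by (simp add: Limsup_const case_prod_unfold zero_ereal_def)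
qed

text \<open>Substitute \<open>t * s\<close> for \<open>t\<close>: a step \<open>t\<close> along
  \<open>s *\<^sub>R d\<close> is a step \<open>t * s\<close> along \<open>d\<close>.\<close>

lemma clarke_dir_deriv_scaleR_le:
  assumes "clarke_dir_deriv f x d \<le> ereal c" "s > 0"
  shows "clarke_dir_deriv f x (s *\<^sub>R d) \<le> ereal (s * c)"
  unfolding clarke_dir_deriv_le_iff
proof (intro allI impI)
  fix \<epsilon> :: real assume "\<epsilon> > 0"
  then have "\<epsilon> / s > 0" using assms by simp
  then obtain \<delta> where "\<delta> > 0" and \<delta>: "\<And>y t. dist y x < \<delta> \<Longrightarrow> 0 < t \<Longrightarrow> t < \<delta> \<Longrightarrow>
      f (y + t *\<^sub>R d) - f y < t * (c + \<epsilon> / s)"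
    using assms(1) unfolding clarke_dir_deriv_le_iff by meson
  show "\<exists>\<delta>>0. \<forall>y t. dist y x < \<delta> \<longrightarrow> 0 < t \<longrightarrow> t < \<delta> \<longrightarrow>
      f (y + t *\<^sub>R s *\<^sub>R d) - f y < t * (s * c + \<epsilon>)"
  proof (intro exI[of _ "min \<delta> (\<delta> / s)"] conjI allI impI)
    fix y and t :: real assume "dist y x < min \<delta> (\<delta> / s)" "0 < t" "t < min \<delta> (\<delta> / s)"
    then have "f (y + (t * s) *\<^sub>R d) - f y < (t * s) * (c + \<epsilon> / s)"
      using assms by (intro \<delta>) (auto simp: field_simps)
    also have "\<dots> = t * (s * c + \<epsilon>)"
      using assms by (simp add: field_simps)
    finally show "f (y + t *\<^sub>R s *\<^sub>R d) - f y < t * (s * c + \<epsilon>)" by simp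
  qed (use \<open>\<delta> > 0\<close> assms in simp)
qed

text \<open>A step along \<open>d + e\<close> splits into a step from \<open>y\<close> along
  \<open>d\<close> and one from \<open>y + t *\<^sub>R d\<close> along \<open>e\<close>. The second
  has a moved base point, which is harmless because the upper limit also runs over base
  points.\<close>

lemma clarke_dir_deriv_add_le:
  assumes "clarke_dir_deriv f x d \<le> ereal c" "clarke_dir_deriv f x e \<le> ereal c'"
  shows "clarke_dir_deriv f x (d + e) \<le> ereal (c + c')"
  unfolding clarke_dir_deriv_le_iff
proof (intro allI impI)
  fix \<epsilon> :: real assume "\<epsilon> > 0"
  then have "\<epsilon> / 2 > 0" by simp
  then obtain \<delta> where "\<delta> > 0"
    and \<delta>: "\<And>y t. dist y x < \<delta> \<Longrightarrow> 0 < t \<Longrightarrow> t < \<delta> \<Longrightarrow> f (y + t *\<^sub>R d) - f y < t * (c + \<epsilon> / 2)"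
    using assms(1) unfolding clarke_dir_deriv_le_iff by meson
  from \<open>\<epsilon> / 2 > 0\<close> obtain \<delta>' where "\<delta>' > 0"
    and \<delta>': "\<And>y t. dist y x < \<delta>' \<Longrightarrow> 0 < t \<Longrightarrow> t < \<delta>' \<Longrightarrow> f (y + t *\<^sub>R e) - f y < t * (c' + \<epsilon> / 2)"
    using assms(2) unfolding clarke_dir_deriv_le_iff by meson
  \<comment> \<open>Keeps the moved base point \<open>y + t *\<^sub>R d\<close> within \<delta>' of
    \<open>x\<close>, half of the distance coming from \<open>y\<close> and half from the step. The
    \<open>+ 1\<close> guards against \<open>d = 0\<close>.\<close>
  define \<eta> where "\<eta> = min \<delta> (min (\<delta>' / 2) (\<delta>' / (2 * (norm d + 1))))"
  have n: "norm d + 1 > 0" by (simp add: add_nonneg_pos)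
  show "\<exists>\<delta>>0. \<forall>y t. dist y x < \<delta> \<longrightarrow> 0 < t \<longrightarrow> t < \<delta> \<longrightarrow>
      f (y + t *\<^sub>R (d + e)) - f y < t * (c + c' + \<epsilon>)"
  proof (intro exI[of _ \<eta>] conjI allI impI)
    show "\<eta> > 0" unfolding \<eta>_def using \<open>\<delta> > 0\<close> \<open>\<delta>' > 0\<close> n by simp
  next
    fix y and t :: real assume y: "dist y x < \<eta>" and t: "0 < t" "t < \<eta>"
    have "t * norm d \<le> t * (norm d + 1)" using t by simp
    also have "\<dots> < \<delta>' / 2" using t n unfolding \<eta>_def by (simp add: field_simps)
    finally have "t * norm d < \<delta>' / 2" .
    moreover have "dist (y + t *\<^sub>R d) x \<le> dist y x + t * norm d"
      using norm_triangle_ineq[of "y - x" "t *\<^sub>R d"] t by (simp add: dist_norm algebra_simps)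
    moreover have "dist y x < \<delta>' / 2" using y unfolding \<eta>_def by simp
    ultimately have "f (y + t *\<^sub>R d + t *\<^sub>R e) - f (y + t *\<^sub>R d) < t * (c' + \<epsilon> / 2)"
      using t \<open>\<delta>' > 0\<close> unfolding \<eta>_def by (intro \<delta>') auto
    moreover have "f (y + t *\<^sub>R d) - f y < t * (c + \<epsilon> / 2)"
      using y t unfolding \<eta>_def by (intro \<delta>) auto
    ultimately show "f (y + t *\<^sub>R (d + e)) - f y < t * (c + c' + \<epsilon>)"
      by (simp add: algebra_simps)
  qed
qed

text \<open>Near \<open>x\<close> all difference quotients along \<open>d\<close> lie between
  \<open>- (L * norm d)\<close> and \<open>L * norm d\<close>, where \<open>L\<close> is a local
  Lipschitz constant.\<close>

lemma clarke_dir_deriv_finite: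
  assumes "locally_lipschitz f"
  shows "\<bar>clarke_dir_deriv f x d\<bar> \<noteq> \<infinity>"
proof -
  from assms obtain e L where "e > 0" and L: "L-lipschitz_on (ball x e) f"
    unfolding locally_lipschitz_def by blast
  have n: "norm d + 1 > 0" by (simp add: add_nonneg_pos)
  define \<delta> where "\<delta> = min (e / 2) (e / (2 * (norm d + 1)))"
  have "\<delta> > 0" using \<open>e > 0\<close> n by (simp add: \<delta>_def)
  have bound: "(f (y + t *\<^sub>R d) - f y) / t \<le> L * norm d \<and>
      - (L * norm d) \<le> (f (y + t *\<^sub>R d) - f y) / t"
    if y: "dist y x < \<delta>" and t: "0 < t" "t < \<delta>" for y and t :: real
  proof -
    have "t * norm d \<le> t * (norm d + 1)" using t by simp
    also have "\<dots> < e / 2" using t n unfolding \<delta>_def by (simp add: field_simps)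
    finally have "t * norm d < e / 2" .
    moreover have "dist (y + t *\<^sub>R d) x \<le> dist y x + t * norm d"
      using norm_triangle_ineq[of "y - x" "t *\<^sub>R d"] t by (simp add: dist_norm algebra_simps)
    moreover have "dist y x < e / 2" using y unfolding \<delta>_def by simp
    ultimately have "y \<in> ball x e" "y + t *\<^sub>R d \<in> ball x e"
      using \<open>e > 0\<close> by (auto simp: dist_commute)
    then have "dist (f (y + t *\<^sub>R d)) (f y) \<le> L * dist (y + t *\<^sub>R d) y"
      using L by (auto dest: lipschitz_onD)
    then show ?thesis
      using t by (simp add: dist_norm abs_le_iff pos_divide_le_eq pos_le_divide_eq algebra_simps)
  qed
  let ?F = "nhds x \<times>\<^sub>F at_right (0::real)"
  let ?q = "\<lambda>(y, t::real). ereal ((f (y + t *\<^sub>R d) - f y) / t)"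
  have "eventually (\<lambda>u. ?q u \<le> ereal (L * norm d)) ?F"
    "eventually (\<lambda>u. ereal (- (L * norm d)) \<le> ?q u) ?F"
    unfolding eventually_nhds_prod_at_right using bound \<open>\<delta> > 0\<close>
    by (auto intro!: exI[of _ \<delta>])
  moreover have "?F \<noteq> bot" by (simp add: prod_filter_eq_bot)
  ultimately have "clarke_dir_deriv f x d \<le> ereal (L * norm d)"
    "ereal (- (L * norm d)) \<le> clarke_dir_deriv f x d"
    unfolding clarke_dir_deriv_def by (auto intro: Limsup_bounded le_Limsup)
  then show ?thesis by auto
qed

text \<open>Hahn--Banach in finite dimension: separate the strict epigraph of \<open>p\<close> from \<open>(d, p d)\<close>.\<close>

lemma sublinear_support:
  fixes p :: "'a::euclidean_space \<Rightarrow> real"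
  assumes add: "\<And>x y. p (x + y) \<le> p x + p y"
    and scale: "\<And>s x. s > 0 \<Longrightarrow> p (s *\<^sub>R x) \<le> s * p x"
    and zero: "p 0 = 0"
  obtains w where "w \<bullet> d = p d" "\<And>x. w \<bullet> x \<le> p x"
proof -
  let ?S = "{u. p (fst u) < snd u}"
  have "convex ?S"
  proof (rule convexI)
    fix u v :: "'a \<times> real" and a b :: real
    assume H: "u \<in> ?S" "v \<in> ?S" "0 \<le> a" "0 \<le> b" "a + b = 1"
    have sc: "p (s *\<^sub>R x) \<le> s * p x" if "s \<ge> 0" for s x
      using scale[of s x] zero that by (cases "s = 0") auto
    have "p (a *\<^sub>R fst u + b *\<^sub>R fst v) \<le> a * p (fst u) + b * p (fst v)"
      using add[of "a *\<^sub>R fst u" "b *\<^sub>R fst v"] sc[of a "fst u"] sc[of b "fst v"] H by linarith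
    also have "\<dots> < a * snd u + b * snd v"
    proof (cases "a = 0")
      case False
      then have "a * p (fst u) < a * snd u" using H by simp
      moreover have "b * p (fst v) \<le> b * snd v" using H by (simp add: mult_left_mono)
      ultimately show ?thesis by simp
    qed (use H in simp)
    finally show "a *\<^sub>R u + b *\<^sub>R v \<in> ?S" by simp
  qed
  moreover have "(0, 1) \<in> ?S" by (simp add: zero)
  then have "?S \<noteq> {}" by blast
  moreover have "?S \<inter> {(d, p d)} = {}" by simp
  ultimately obtain n c where n: "n \<noteq> 0" "\<forall>u\<in>?S. n \<bullet> u \<le> c" "\<forall>u\<in>{(d, p d)}. n \<bullet> u \<ge> c"
    using separating_hyperplane_sets[of ?S "{(d, p d)}"] convex_singleton by blast
  obtain a b where ab: "n = (a, b)" by (cases n)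
  have sep: "a \<bullet> x + b * s \<le> a \<bullet> d + b * p d" if "p x < s" for x s
    using n(2)[rule_format, of "(x, s)"] n(3) that by (simp add: ab)
  \<comment> \<open>The epigraph is unbounded upwards, so its normal cannot point up.\<close>
  have "b \<le> 0"
  proof (rule ccontr)
    assume "\<not> b \<le> 0"
    then show False
      using sep[of d "p d + 1"] by (simp add: algebra_simps)
  qed
  \<comment> \<open>A vertical hyperplane is excluded: moving from \<open>d\<close> in the direction
    \<open>a\<close> would stay in the half-space only for \<open>a = 0\<close>.\<close>
  moreover have "b \<noteq> 0"
  proof
    assume "b = 0"
    then have "a \<bullet> (d + a) \<le> a \<bullet> d" using sep[of "d + a" "p (d + a) + 1"] by simp
    then have "a = 0" by (simp add: inner_add_right flip: power2_norm_eq_inner)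
    with \<open>b = 0\<close> n ab show False by (simp add: zero_prod_def)
  qed
  ultimately have "b < 0" by simp
  \<comment> \<open>Normalizing the last component of the normal to -1 turns the hyperplane into the
    graph of an affine function with gradient \<open>w\<close>.\<close>
  define w where "w = (- 1 / b) *\<^sub>R a"
  have w: "w \<bullet> x - p x \<le> w \<bullet> d - p d" for x
  proof (rule field_le_epsilon)
    fix e :: real assume "e > 0"
    then have "a \<bullet> x + b * (p x + e) \<le> a \<bullet> d + b * p d" by (intro sep) simp
    then have "(a \<bullet> d - a \<bullet> x) / b \<le> p x - p d + e"
      using \<open>b < 0\<close> by (subst neg_divide_le_eq) (auto simp: algebra_simps)
    then show "w \<bullet> x - p x \<le> w \<bullet> d - p d + e"
      by (simp add: w_def diff_divide_distrib)
  qed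
  \<comment> \<open>The point 0 gives \<open>p d \<le> w \<bullet> d\<close>; the point
    \<open>2 *\<^sub>R d\<close> with homogeneity gives the converse.\<close>
  have eq: "w \<bullet> d = p d"
    using w[of 0] w[of "2 *\<^sub>R d"] scale[of 2 d] zero by simp
  show thesis
    using that[of w] eq w by fastforce
qed

lemma clarke_dir_deriv_attained:
  fixes f :: "'a::euclidean_space \<Rightarrow> real"
  assumes "locally_lipschitz f"
  obtains w where "w \<in> clarke_subdifferential f x" "ereal (w \<bullet> d) = clarke_dir_deriv f x d"
proof -
  define p where "p = (\<lambda>d. real_of_ereal (clarke_dir_deriv f x d))"
  have p: "clarke_dir_deriv f x d = ereal (p d)" for d
    using clarke_dir_deriv_finite[OF assms, of x d] by (simp add: p_def ereal_real)
  have "p (u + v) \<le> p u + p v" for u v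
    using clarke_dir_deriv_add_le[of f x u "p u" v "p v"] by (simp add: p)
  moreover have "p (s *\<^sub>R u) \<le> s * p u" if "s > 0" for s u
    using clarke_dir_deriv_scaleR_le[of f x u "p u" s] that by (simp add: p)
  moreover have "p 0 = 0"
    using clarke_dir_deriv_0[of f x] by (simp add: p_def)
  ultimately obtain w where "w \<bullet> d = p d" "\<And>e. w \<bullet> e \<le> p e"
    using sublinear_support[of p d] by blast
  then show thesis
    using that[of w] by (simp add: clarke_subdifferential_def p)
qed

text \<open>Since the directional derivative is attained by a subgradient, it is at most
  \<open>M * norm d\<close> at every point of the segment from \<open>x\<close> to \<open>y\<close>,
  where \<open>d = y - x\<close>. Such local slope bounds add up along the segment.\<close>

lemma lipschitz_on_clarke_bound:
  fixes f :: "'a::euclidean_space \<Rightarrow> real"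
  assumes "locally_lipschitz f" "convex S" "M \<ge> 0"
    and M: "\<And>x w. x \<in> S \<Longrightarrow> w \<in> clarke_subdifferential f x \<Longrightarrow> norm w \<le> M"
  shows "M-lipschitz_on S f"
proof -
  have increase: "f y - f x \<le> M * norm (y - x)" if "x \<in> S" "y \<in> S" for x y
  proof (rule field_le_epsilon)
    fix \<epsilon> :: real assume "\<epsilon> > 0"
    define d where "d = y - x"
    define g where "g = (\<lambda>s. f (x + s *\<^sub>R d))"
    have n: "norm d + 1 > 0" by (simp add: add_nonneg_pos)
    \<comment> \<open>Bisection: the estimate is additive over adjacent intervals, so it suffices to
      prove it for all short intervals around each point of [0, 1]. The slack \<epsilon> absorbs the
      strict upper limit.\<close>
    have "g 1 - g 0 \<le> (1 - 0) * (M * norm d + \<epsilon>)"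
    proof (rule Bolzano[of 0 1 "\<lambda>a b. g b - g a \<le> (b - a) * (M * norm d + \<epsilon>)"])
      fix s :: real assume s: "0 \<le> s" "s \<le> 1"
      have "x + s *\<^sub>R d \<in> S"
        using convexD[OF \<open>convex S\<close> \<open>x \<in> S\<close> \<open>y \<in> S\<close>, of "1 - s" s] s
        by (simp add: d_def algebra_simps)
      moreover obtain w where w: "w \<in> clarke_subdifferential f (x + s *\<^sub>R d)"
        "ereal (w \<bullet> d) = clarke_dir_deriv f (x + s *\<^sub>R d) d"
        using clarke_dir_deriv_attained[OF assms(1)] .
      ultimately have "norm w \<le> M" using M by blast
      then have "w \<bullet> d \<le> M * norm d"
        using norm_cauchy_schwarz[of w d] by (meson mult_right_mono norm_ge_zero order_trans)
      then have "clarke_dir_deriv f (x + s *\<^sub>R d) d \<le> ereal (M * norm d)"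
        by (simp flip: w(2))
      then obtain \<delta> where "\<delta> > 0" and \<delta>: "\<And>z t. dist z (x + s *\<^sub>R d) < \<delta> \<Longrightarrow> 0 < t \<Longrightarrow> t < \<delta> \<Longrightarrow>
          f (z + t *\<^sub>R d) - f z < t * (M * norm d + \<epsilon>)"
        using \<open>\<epsilon> > 0\<close> unfolding clarke_dir_deriv_le_iff by meson
      show "\<exists>\<eta>>0. \<forall>a b. a \<le> s \<and> s \<le> b \<and> b - a < \<eta> \<longrightarrow> g b - g a \<le> (b - a) * (M * norm d + \<epsilon>)"
      proof (intro exI[of _ "min \<delta> (\<delta> / (norm d + 1))"] conjI allI impI)
        show "0 < min \<delta> (\<delta> / (norm d + 1))" using \<open>\<delta> > 0\<close> n by simp
      next
        fix a b assume ab: "a \<le> s \<and> s \<le> b \<and> b - a < min \<delta> (\<delta> / (norm d + 1))"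
        have "dist (x + a *\<^sub>R d) (x + s *\<^sub>R d) = (s - a) * norm d"
        proof -
          have "x + a *\<^sub>R d - (x + s *\<^sub>R d) = (a - s) *\<^sub>R d" by (simp add: algebra_simps)
          then show ?thesis using ab by (simp add: dist_norm)
        qed
        also have "\<dots> \<le> (b - a) * (norm d + 1)"
          using ab by (intro mult_mono) auto
        also have "\<dots> < \<delta>" using ab n by (simp add: field_simps)
        finally have "dist (x + a *\<^sub>R d) (x + s *\<^sub>R d) < \<delta>" .
        then have "a < b \<Longrightarrow> f (x + a *\<^sub>R d + (b - a) *\<^sub>R d) - f (x + a *\<^sub>R d) < (b - a) * (M * norm d + \<epsilon>)"
          using ab by (intro \<delta>) auto
        then show "g b - g a \<le> (b - a) * (M * norm d + \<epsilon>)"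
          using ab by (cases "a = b") (auto simp: g_def algebra_simps)
      qed
    qed (auto simp: algebra_simps)
    then show "f y - f x \<le> M * norm (y - x) + \<epsilon>"
      by (simp add: g_def d_def)
  qed
  show ?thesis
  proof (rule lipschitz_onI)
    show "dist (f x) (f y) \<le> M * dist x y" if "x \<in> S" "y \<in> S" for x y
      using increase[of x y] increase[of y x] that
      by (simp add: dist_norm norm_minus_commute abs_le_iff)
  qed fact
qed

subsection \<open>Frobenius norm and matrix algebra\<close>

text \<open>Cauchy-Schwarz for each entry of the product; the resulting double sum factors.\<close>

lemma norm_matrix_mult_le:
  fixes A :: "real ^ 'm ^ 'n" and B :: "real ^ 'k ^ 'm"
  shows "norm (A ** B) \<le> norm A * norm B"
proof (rule power2_le_imp_le)
  have sq: "(norm C)\<^sup>2 = (\<Sum>i\<in>UNIV. \<Sum>j\<in>UNIV. (C $ i $ j)\<^sup>2)" for C :: "real ^ 'x ^ 'y"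
    by (simp add: norm_matrix_eq_frobenius sum_nonneg)
  have "(norm (A ** B))\<^sup>2 \<le>
      (\<Sum>i\<in>UNIV. \<Sum>j\<in>UNIV. (\<Sum>k\<in>UNIV. (A $ i $ k)\<^sup>2) * (\<Sum>k\<in>UNIV. (B $ k $ j)\<^sup>2))"
    unfolding sq matrix_matrix_mult_def
    by (simp, intro sum_mono Cauchy_Schwarz_ineq_sum)
  also have "\<dots> = (\<Sum>i\<in>UNIV. \<Sum>k\<in>UNIV. (A $ i $ k)\<^sup>2) * (\<Sum>j\<in>UNIV. \<Sum>k\<in>UNIV. (B $ k $ j)\<^sup>2)"
    by (rule sum_product[symmetric])
  also have "\<dots> = (norm A * norm B)\<^sup>2"
    unfolding power_mult_distrib sq by (subst (3) sum.swap) simp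
  finally show "(norm (A ** B))\<^sup>2 \<le> (norm A * norm B)\<^sup>2" .
qed simp

text \<open>Supplies the distributive laws, continuity and the product rule for derivatives of
  matrix products.\<close>

interpretation matrix_mult: bounded_bilinear
  "(**) :: real ^ 'm ^ 'n \<Rightarrow> real ^ 'k ^ 'm \<Rightarrow> real ^ 'k ^ 'n"
proof
  show "\<exists>K. \<forall>(A :: real ^ 'm ^ 'n) (B :: real ^ 'k ^ 'm). norm (A ** B) \<le> norm A * norm B * K"
    using norm_matrix_mult_le by (intro exI[of _ 1]) auto
qed (simp_all add: matrix_matrix_mult_def vec_eq_iff algebra_simps sum.distrib sum_distrib_left)

lemma bounded_linear_transpose: "bounded_linear (transpose :: real ^ 'm ^ 'n \<Rightarrow> real ^ 'n ^ 'm)"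
  by (rule linear_conv_bounded_linear[THEN iffD1], rule linearI)
    (simp_all add: transpose_def vec_eq_iff)

lemmas transpose_add = linear_add[OF bounded_linear.linear[OF bounded_linear_transpose]]
lemmas transpose_diff = linear_diff[OF bounded_linear.linear[OF bounded_linear_transpose]]

lemmas matrix_expand = matrix_mult.add_left matrix_mult.add_right matrix_mult.diff_left
  matrix_mult.diff_right matrix_mult.scaleR_left matrix_mult.scaleR_right
  matrix_mult.minus_left matrix_mult.minus_right matrix_mul_assoc

lemma inner_matrix_mult_left:
  fixes A :: "real ^ 'm ^ 'n" and B :: "real ^ 'k ^ 'm" and C :: "real ^ 'k ^ 'n"
  shows "(A ** B) \<bullet> C = B \<bullet> (transpose A ** C)"
proof -
  have "(A ** B) \<bullet> C = (\<Sum>i\<in>UNIV. \<Sum>j\<in>UNIV. \<Sum>k\<in>UNIV. A $ i $ k * B $ k $ j * C $ i $ j)"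
    by (simp add: inner_matrix_eq_frobenius matrix_matrix_mult_def sum_distrib_right)
  also have "\<dots> = (\<Sum>i\<in>UNIV. \<Sum>k\<in>UNIV. \<Sum>j\<in>UNIV. A $ i $ k * B $ k $ j * C $ i $ j)"
    by (intro sum.cong refl sum.swap)
  also have "\<dots> = (\<Sum>k\<in>UNIV. \<Sum>i\<in>UNIV. \<Sum>j\<in>UNIV. A $ i $ k * B $ k $ j * C $ i $ j)"
    by (rule sum.swap)
  also have "\<dots> = (\<Sum>k\<in>UNIV. \<Sum>j\<in>UNIV. \<Sum>i\<in>UNIV. A $ i $ k * B $ k $ j * C $ i $ j)"
    by (intro sum.cong refl sum.swap)
  also have "\<dots> = B \<bullet> (transpose A ** C)"
    by (simp add: inner_matrix_eq_frobenius matrix_matrix_mult_def transpose_def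
        sum_distrib_left mult_ac)
  finally show ?thesis .
qed

subsection \<open>Defect of the Gram matrix\<close>

definition gram_defect :: "real ^ 'p ^ 'n \<Rightarrow> real ^ 'p ^ 'p" where
  "gram_defect X = transpose X ** X - mat 1"

lemma stiefel_iff: "X \<in> stiefel \<longleftrightarrow> gram_defect X = 0"
  by (simp add: stiefel_def gram_defect_def)

lemma Omega_iff: "X \<in> Omega r \<longleftrightarrow> norm (gram_defect X) \<le> r"
  by (simp add: Omega_def gram_defect_def)

lemma penalty_fun_eq: "penalty_fun f \<beta> X = f (dissolve X) + \<beta> / 4 * (norm (gram_defect X))\<^sup>2"
  by (simp add: penalty_fun_def gram_defect_def)

lemma gram_eq: "transpose X ** X = mat 1 + gram_defect X"
  by (simp add: gram_defect_def)

lemma transpose_gram_defect: "transpose (gram_defect X) = gram_defect X"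
  by (simp add: gram_defect_def transpose_diff matrix_transpose_mul)

text \<open>The Taylor polynomial of degree 2 at 0 of (1 + d)^(-1/2), evaluated at a matrix.\<close>

definition isqrt_approx :: "real ^ 'p ^ 'p \<Rightarrow> real ^ 'p ^ 'p" where
  "isqrt_approx D = mat 1 - (1 / 2) *\<^sub>R D + (3 / 8) *\<^sub>R (D ** D)"

lemma dissolve_eq: "dissolve X = X ** isqrt_approx (gram_defect X)"
  unfolding dissolve_def gram_eq isqrt_approx_def
  by (simp add: matrix_expand scaleR_add_right scaleR_diff_right, simp add: vec_eq_iff)

text \<open>Needed for two symmetric factors: \<open>isqrt_approx\<close> of the defect, and the
  factor \<open>mat 1 - t *\<^sub>R D\<close> of the descent curve.\<close>

lemma gram_defect_mult:
  assumes "transpose B = B"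
  shows "gram_defect (X ** B) = B ** (mat 1 + gram_defect X) ** B - mat 1"
proof -
  have "transpose (X ** B) ** (X ** B) = B ** (transpose X ** X) ** B"
    by (simp add: matrix_transpose_mul assms matrix_mul_assoc)
  then show ?thesis
    by (simp add: gram_defect_def)
qed

text \<open>All factors are polynomials in \<open>D\<close>, so this is the scalar identity for (1 +
  d) q(d)^2 - 1 with q(d) = 1 - d/2 + 3 d^2/8. The orders 1 and 2 cancel because q approximates (1 +
  d)^(-1/2) to second order.\<close>

lemma gram_defect_dissolve:
  "gram_defect (dissolve X) = (let D = gram_defect X in
     (5 / 8) *\<^sub>R (D ** D ** D) - (15 / 64) *\<^sub>R (D ** D ** D ** D)
     + (9 / 64) *\<^sub>R (D ** D ** D ** D ** D))"
proof -
  have "transpose (isqrt_approx (gram_defect X)) = isqrt_approx (gram_defect X)"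
    by (simp add: isqrt_approx_def transpose_diff transpose_add
        transpose_scalar matrix_transpose_mul transpose_gram_defect)
  from gram_defect_mult[OF this, of X] show ?thesis
    unfolding dissolve_eq isqrt_approx_def Let_def
    by (simp add: matrix_expand scaleR_add_right scaleR_diff_right, simp add: vec_eq_iff)
qed

text \<open>The absolute values of the three coefficients sum to exactly 1: 5/8 + 15/64 + 9/64 =
  1.\<close>

lemma norm_gram_defect_dissolve_le:
  fixes X :: "real ^ 'p ^ 'n"
  assumes "norm (gram_defect X) \<le> 1"
  shows "norm (gram_defect (dissolve X)) \<le> norm (gram_defect X) ^ 3"
proof -
  let ?D = "gram_defect X"
  have 2: "norm (?D ** ?D) \<le> norm ?D ^ 2"
    using norm_matrix_mult_le[of ?D ?D] by (simp add: power2_eq_square)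
  have step: "norm (A ** ?D) \<le> norm ?D ^ Suc k" if "norm A \<le> norm ?D ^ k"
    for A :: "real ^ 'p ^ 'p" and k
    using norm_matrix_mult_le[of A ?D] mult_right_mono[OF that norm_ge_zero[of ?D]]
    by (simp add: mult.commute)
  have 3: "norm (?D ** ?D ** ?D) \<le> norm ?D ^ 3"
    using step[OF 2] by (simp add: eval_nat_numeral)
  have 4: "norm (?D ** ?D ** ?D ** ?D) \<le> norm ?D ^ 4"
    using step[OF 3] by (simp add: eval_nat_numeral)
  have 5: "norm (?D ** ?D ** ?D ** ?D ** ?D) \<le> norm ?D ^ 5"
    using step[OF 4] by (simp add: eval_nat_numeral)
  have "norm ?D ^ 4 \<le> norm ?D ^ 3" "norm ?D ^ 5 \<le> norm ?D ^ 3"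
    using assms by (auto intro: power_decreasing)
  moreover have "norm (gram_defect (dissolve X)) \<le>
      5 / 8 * norm (?D ** ?D ** ?D) + 15 / 64 * norm (?D ** ?D ** ?D ** ?D)
      + 9 / 64 * norm (?D ** ?D ** ?D ** ?D ** ?D)"
    unfolding gram_defect_dissolve Let_def
    by (rule norm_triangle_le, rule add_mono, rule norm_triangle_le_diff) simp_all
  ultimately show ?thesis
    using 3 4 5 by linarith
qed

section \<open>Continuity, size estimates and nearby points of the Stiefel manifold\<close>

lemma continuous_gram_defect:
  "continuous_on UNIV (gram_defect :: real ^ 'p ^ 'n \<Rightarrow> _)"
  unfolding gram_defect_def
  by (intro continuous_intros matrix_mult.continuous_on
      bounded_linear.continuous_on[OF bounded_linear_transpose])

lemma continuous_dissolve:
  "continuous_on UNIV (dissolve :: real ^ 'p ^ 'n \<Rightarrow> _)"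
  unfolding dissolve_eq isqrt_approx_def
  by (intro continuous_intros matrix_mult.continuous_on continuous_gram_defect)

text \<open>The squared norm is the trace of the Gram matrix, its inner product with the identity.
  The bound is the same for all such \<open>X\<close>, hence for all iterates of
  \<open>dissolve\<close> below.\<close>

lemma norm_le_of_norm_gram_defect_le:
  fixes X :: "real ^ 'p ^ 'n"
  assumes "norm (gram_defect X) \<le> 1"
  shows "norm X \<le> norm (mat 1 :: real ^ 'p ^ 'p) + 1"
proof (rule power2_le_imp_le)
  let ?I = "mat 1 :: real ^ 'p ^ 'p"
  have "(norm X)\<^sup>2 = ?I \<bullet> (transpose X ** X)"
    using inner_matrix_mult_left[of X ?I X] by (simp add: power2_norm_eq_inner)
  also have "\<dots> \<le> norm ?I * norm (?I + gram_defect X)"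
    unfolding gram_eq by (rule norm_cauchy_schwarz)
  also have "\<dots> \<le> (norm ?I + 1) * (norm ?I + 1)"
    using norm_triangle_ineq[of ?I "gram_defect X"] assms by (intro mult_mono) auto
  finally show "(norm X)\<^sup>2 \<le> (norm ?I + 1)\<^sup>2" by (simp add: power2_eq_square)
qed simp

lemma norm_dissolve_diff_le:
  fixes X :: "real ^ 'p ^ 'n"
  assumes "norm (gram_defect X) \<le> 1"
  shows "norm (dissolve X - X) \<le> (norm (mat 1 :: real ^ 'p ^ 'p) + 1) * norm (gram_defect X)"
proof -
  let ?D = "gram_defect X"
  have "dissolve X - X = X ** ((3 / 8) *\<^sub>R (?D ** ?D) - (1 / 2) *\<^sub>R ?D)"
    by (simp add: dissolve_eq isqrt_approx_def matrix_expand)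
  also have "norm \<dots> \<le> norm X * norm ((3 / 8) *\<^sub>R (?D ** ?D) - (1 / 2) *\<^sub>R ?D)"
    by (rule norm_matrix_mult_le)
  also have "\<dots> \<le> (norm (mat 1 :: real ^ 'p ^ 'p) + 1) * norm ?D"
  proof (rule mult_mono)
    have "norm ((3 / 8) *\<^sub>R (?D ** ?D) - (1 / 2) *\<^sub>R ?D) \<le> 3 / 8 * norm (?D ** ?D) + 1 / 2 * norm ?D"
      by (rule norm_triangle_le_diff) simp
    moreover have "norm (?D ** ?D) \<le> norm ?D"
      using norm_matrix_mult_le[of ?D ?D] mult_left_mono[OF assms norm_ge_zero[of ?D]] by simp
    moreover have "0 \<le> norm ?D" by simp
    ultimately show "norm ((3 / 8) *\<^sub>R (?D ** ?D) - (1 / 2) *\<^sub>R ?D) \<le> norm ?D" by linarith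
  qed (use norm_le_of_norm_gram_defect_le[OF assms] in auto)
  finally show ?thesis .
qed

text \<open>Iterating \<open>dissolve\<close> converges to a point of the Stiefel manifold, since the defect is at
  least halved in every step and bounds the step length.\<close>

lemma stiefel_point_near:
  fixes X :: "real ^ 'p ^ 'n"
  assumes "norm (gram_defect X) \<le> 1 / 2"
  obtains P where "P \<in> stiefel"
    "norm (P - X) \<le> 2 * (norm (mat 1 :: real ^ 'p ^ 'p) + 1) * norm (gram_defect X)"
proof -
  define K where "K = norm (mat 1 :: real ^ 'p ^ 'p) + 1"
  define \<delta> where "\<delta> = norm (gram_defect X)"
  define Z where "Z = (\<lambda>k. (dissolve ^^ k) X)"
  have Z: "Z 0 = X" "Z (Suc k) = dissolve (Z k)" for k
    by (simp_all add: Z_def)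
  have "K > 0" "\<delta> \<ge> 0" "\<delta> \<le> 1 / 2"
    using assms by (simp_all add: K_def \<delta>_def add_nonneg_pos)
  \<comment> \<open>Of the cubic decrease only a factor 1/2 per step is kept, which is enough for a
    geometric series.\<close>
  have defect: "norm (gram_defect (Z k)) \<le> \<delta> * (1 / 2) ^ k" for k
  proof (induction k)
    case (Suc k)
    have "\<delta> * (1 / 2) ^ k \<le> 1 / 2 * 1"
      using \<open>\<delta> \<ge> 0\<close> \<open>\<delta> \<le> 1 / 2\<close> by (intro mult_mono power_le_one) auto
    then have half: "norm (gram_defect (Z k)) \<le> 1 / 2" using Suc by simp
    then have "norm (gram_defect (Z (Suc k))) \<le> norm (gram_defect (Z k)) ^ 3"
      unfolding Z by (intro norm_gram_defect_dissolve_le) simp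
    also have "\<dots> = norm (gram_defect (Z k)) * norm (gram_defect (Z k)) * norm (gram_defect (Z k))"
      by (simp add: power3_eq_cube)
    also have "\<dots> \<le> 1 / 2 * 1 * norm (gram_defect (Z k))"
      using half by (intro mult_mono) auto
    also have "\<dots> \<le> \<delta> * (1 / 2) ^ Suc k" using Suc by simp
    finally show ?case .
  qed (simp add: Z \<delta>_def)
  define a where "a = (\<lambda>k. Z (Suc k) - Z k)"
  have a: "norm (a k) \<le> K * \<delta> * (1 / 2) ^ k" for k
  proof -
    have "\<delta> * (1 / 2) ^ k \<le> 1 * 1"
      using \<open>\<delta> \<ge> 0\<close> \<open>\<delta> \<le> 1 / 2\<close> by (intro mult_mono power_le_one) auto
    then have "norm (a k) \<le> K * norm (gram_defect (Z k))"
      using defect[of k] unfolding a_def K_def Z by (intro norm_dissolve_diff_le) simp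
    also have "\<dots> \<le> K * (\<delta> * (1 / 2) ^ k)"
      using defect[of k] \<open>K > 0\<close> by simp
    finally show ?thesis by (simp add: mult.assoc)
  qed
  \<comment> \<open>The sum of this majorant of the step lengths is the source of the factor 2 in
    the distance bound.\<close>
  have geo: "(\<lambda>k. K * \<delta> * (1 / 2) ^ k) sums (K * \<delta> * 2)"
    using geometric_sums[of "1 / 2 :: real"] by (intro sums_mult) simp
  have sa: "summable (\<lambda>k. norm (a k))"
    using a by (intro summable_comparison_test'[OF sums_summable[OF geo]]) simp
  define P where "P = X + suminf a"
  have "Z = (\<lambda>n. X + sum a {..<n})"
    unfolding a_def sum_lessThan_telescope by (simp add: Z(1))
  then have lim: "Z \<longlonglongrightarrow> P"
    using summable_LIMSEQ[OF summable_norm_cancel[OF sa]] unfolding P_def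
    by (auto intro: tendsto_add)
  have "(\<lambda>k. gram_defect (Z k)) \<longlonglongrightarrow> gram_defect P"
    using continuous_on_tendsto_compose[OF continuous_gram_defect lim] by simp
  moreover have "(\<lambda>k. gram_defect (Z k)) \<longlonglongrightarrow> 0"
  proof (rule Lim_null_comparison)
    show "eventually (\<lambda>k. norm (gram_defect (Z k)) \<le> \<delta> * (1 / 2) ^ k) sequentially"
      using defect by simp
    show "(\<lambda>k. \<delta> * (1 / 2) ^ k) \<longlonglongrightarrow> 0"
      by (intro tendsto_mult_right_zero LIMSEQ_realpow_zero) auto
  qed
  ultimately have "P \<in> stiefel"
    unfolding stiefel_iff by (rule LIMSEQ_unique)
  moreover have "norm (P - X) \<le> (\<Sum>k. norm (a k))"
    unfolding P_def using summable_norm[OF sa] by simp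
  then have "norm (P - X) \<le> K * \<delta> * 2"
    using suminf_le[OF a sa sums_summable[OF geo]] sums_unique[OF geo] by simp
  ultimately show thesis
    using that[of P] by (simp add: K_def \<delta>_def algebra_simps)
qed

subsection \<open>Exactness of the penalty\<close>

text \<open>As \<open>f\<close> is only Lipschitz, \<open>penalty_fun\<close> need not be
  differentiable along a curve. The first-order argument therefore passes to the limit in difference
  quotients.\<close>

lemma has_vector_derivative_difference_quotient:
  assumes "(f has_vector_derivative f') (at (0::real))"
  shows "((\<lambda>t. (f t - f 0) /\<^sub>R t) \<longlongrightarrow> f') (at_right 0)"
proof -
  have "((\<lambda>t. (f t - (f 0 + (t - 0) *\<^sub>R f')) /\<^sub>R norm (t - 0)) \<longlongrightarrow> 0) (at_right 0)"
    using has_vector_derivative_at_within[OF assms, of "{0<..}"]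
    by (simp add: has_vector_derivative_def has_derivative_within inverse_eq_divide)
  then have "((\<lambda>t. (f t - f 0) /\<^sub>R t - f') \<longlongrightarrow> 0) (at_right 0)"
    by (rule Lim_transform_eventually)
      (auto simp: eventually_at_right_field algebra_simps intro!: exI[of _ 1])
  then show ?thesis
    by (simp add: Lim_null[symmetric])
qed

section \<open>First-order descent along the curve X (I - t D)\<close>

lemma has_vector_derivative_line:
  "((\<lambda>t. mat 1 - t *\<^sub>R D) has_vector_derivative - D) (at (0::real))"
  for D :: "real ^ 'p ^ 'p"
  by (auto intro!: derivative_eq_intros)

lemma gram_defect_curve_derivative:
  fixes X :: "real ^ 'p ^ 'n"
  defines "D \<equiv> gram_defect X"
  shows "((\<lambda>t. gram_defect (X ** (mat 1 - t *\<^sub>R D)))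
    has_vector_derivative (- 2) *\<^sub>R (D + D ** D)) (at 0)"
proof -
  have "transpose (mat 1 - t *\<^sub>R D) = mat 1 - t *\<^sub>R D" for t
    by (simp add: D_def transpose_diff transpose_scalar transpose_gram_defect)
  then have eq: "(\<lambda>t. gram_defect (X ** (mat 1 - t *\<^sub>R D))) =
      (\<lambda>t. (mat 1 - t *\<^sub>R D) ** (mat 1 + D) ** (mat 1 - t *\<^sub>R D) - mat 1)"
    by (simp add: gram_defect_mult D_def)
  show ?thesis
    unfolding eq
    by (rule has_vector_derivative_eq_rhs[OF has_vector_derivative_diff[OF
          matrix_mult.has_vector_derivative[OF matrix_mult.has_vector_derivative[OF
            has_vector_derivative_line has_vector_derivative_const]
            has_vector_derivative_line] has_vector_derivative_const]])
      (simp add: matrix_expand scaleR_add_right, simp add: vec_eq_iff)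
qed

text \<open>With q(d) = 1 - d/2 + 3 d^2/8 the product rule gives - d q(d) - 2 (d + d^2) q'(d), in
  which the linear and quadratic terms cancel and - 15/8 d^3 is left.\<close>

lemma dissolve_curve_derivative:
  fixes X :: "real ^ 'p ^ 'n"
  defines "D \<equiv> gram_defect X"
  shows "((\<lambda>t. dissolve (X ** (mat 1 - t *\<^sub>R D)))
    has_vector_derivative - (15 / 8) *\<^sub>R (X ** D ** D ** D)) (at 0)"
proof -
  note dD = gram_defect_curve_derivative[of X, folded D_def]
  have 0: "gram_defect (X ** (mat 1 - 0 *\<^sub>R D)) = D"
    by (simp add: D_def)
  show ?thesis
    unfolding dissolve_eq isqrt_approx_def
    by (rule has_vector_derivative_eq_rhs[OF matrix_mult.has_vector_derivative[OF
          matrix_mult.has_vector_derivative[OF has_vector_derivative_const has_vector_derivative_line]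
          has_vector_derivative_add[OF has_vector_derivative_diff[OF has_vector_derivative_const
            bounded_linear.has_vector_derivative[OF bounded_linear_scaleR_right dD]]
            bounded_linear.has_vector_derivative[OF bounded_linear_scaleR_right
              matrix_mult.has_vector_derivative[OF dD dD]]]]])
      (simp add: 0 D_def[symmetric] matrix_expand scaleR_add_right scaleR_diff_right, simp add: vec_eq_iff)
qed

text \<open>Identifies the rate of decrease of the penalty with a squared norm, so that an upper
  bound on this rate also bounds the factor \<open>X ** D\<close> in the velocity of
  \<open>dissolve\<close>.\<close>

lemma norm_mult_gram_defect_sq:
  "(norm (X ** gram_defect X))\<^sup>2 = gram_defect X \<bullet> (gram_defect X + gram_defect X ** gram_defect X)"
  by (simp add: power2_norm_eq_inner inner_matrix_mult_left matrix_mul_assoc gram_eq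
      matrix_mult.add_left)

lemma local_minimizer_penalty_feasible:
  fixes X :: "real ^ 'p ^ 'n"
  assumes min: "local_minimizer_on (penalty_fun f \<beta>) UNIV X"
    and D: "norm (gram_defect X) \<le> r"
    and lip: "M-lipschitz_on (ball (dissolve X) e) f" and "e > 0"
    and "\<beta> > 0" "0 < r" and r: "r * (2 * \<beta> + 16 * M) < \<beta>"
  shows "X \<in> stiefel"
proof (rule ccontr)
  let ?D = "gram_defect X"
  let ?Y = "\<lambda>t. X ** (mat 1 - t *\<^sub>R ?D)"
  let ?q = "?D \<bullet> (?D + ?D ** ?D)"
  assume "X \<notin> stiefel"
  then have pos: "norm ?D > 0" by (simp add: stiefel_iff)
  have "M \<ge> 0" by (rule lipschitz_on_nonneg[OF lip])
  then have "r * M \<ge> 0" "r * \<beta> > 0" using \<open>0 < r\<close> \<open>\<beta> > 0\<close> by auto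
  then have rM: "2 * (r * \<beta>) + 16 * (r * M) < \<beta>"
    using r by (simp add: algebra_simps)
  with \<open>r * M \<ge> 0\<close> have "2 * r * \<beta> < 1 * \<beta>" by simp
  then have "r < 1 / 2" using \<open>\<beta> > 0\<close> by simp
  have contY: "((\<lambda>t. ?Y t) \<longlongrightarrow> X) (at_right 0)"
  proof -
    have "isCont ?Y 0"
      by (intro continuous_intros matrix_mult.continuous)
    then show ?thesis
      unfolding isCont_def by (simp add: filterlim_at_split)
  qed
  from min obtain \<epsilon> where "\<epsilon> > 0" and \<epsilon>: "\<And>Z. dist Z X < \<epsilon> \<Longrightarrow> penalty_fun f \<beta> X \<le> penalty_fun f \<beta> Z"
    unfolding local_minimizer_on_def by auto
  have "eventually (\<lambda>t. dist (?Y t) X < \<epsilon>) (at_right 0)"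
    using contY \<open>\<epsilon> > 0\<close> by (rule tendstoD)
  moreover have "((\<lambda>t. dissolve (?Y t)) \<longlongrightarrow> dissolve X) (at_right 0)"
    using continuous_on_tendsto_compose[OF continuous_dissolve contY] by simp
  then have "eventually (\<lambda>t. dist (dissolve (?Y t)) (dissolve X) < e) (at_right 0)"
    using \<open>e > 0\<close> by (rule tendstoD)
  moreover have "eventually (\<lambda>t::real. t > 0) (at_right 0)"
    by (rule eventually_at_right_less)
  \<comment> \<open>Minimality along the curve, with the change of \<open>f\<close> replaced by its
    Lipschitz bound, divided by \<open>t\<close>. Writing \<open>?Y 0\<close> for \<open>X\<close>
    gives the shape of difference quotients at 0.\<close>
  ultimately have ev: "eventually (\<lambda>t. 0 \<le> M * norm ((dissolve (?Y t) - dissolve (?Y 0)) /\<^sub>R t)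
      + \<beta> / 4 * ((gram_defect (?Y t) \<bullet> gram_defect (?Y t) - gram_defect (?Y 0) \<bullet> gram_defect (?Y 0)) /\<^sub>R t))
    (at_right 0)"
  proof eventually_elim
    case (elim t)
    let ?u = "norm (dissolve (?Y t) - dissolve X)"
    let ?v = "gram_defect (?Y t) \<bullet> gram_defect (?Y t) - ?D \<bullet> ?D"
    have "\<bar>f (dissolve (?Y t)) - f (dissolve X)\<bar> \<le> M * ?u"
      using lipschitz_onD[OF lip, of "dissolve (?Y t)" "dissolve X"] elim \<open>e > 0\<close>
      by (simp add: dist_norm norm_minus_commute)
    moreover have "penalty_fun f \<beta> X \<le> penalty_fun f \<beta> (?Y t)"
      using elim by (intro \<epsilon>) simp
    ultimately have "0 \<le> M * ?u + \<beta> / 4 * ?v"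
      unfolding penalty_fun_eq power2_norm_eq_inner by (simp add: algebra_simps)
    then have "0 \<le> (M * ?u + \<beta> / 4 * ?v) / t"
      using elim by simp
    also have "\<dots> = M * norm ((dissolve (?Y t) - dissolve X) /\<^sub>R t) + \<beta> / 4 * (?v /\<^sub>R t)"
    proof -
      have "norm ((dissolve (?Y t) - dissolve X) /\<^sub>R t) = ?u / t" "?v /\<^sub>R t = ?v / t"
        using elim by (simp_all add: divide_inverse mult.commute)
      then show ?thesis by (simp only: add_divide_distrib times_divide_eq_right)
    qed
    finally show ?case by simp
  qed
  have "((\<lambda>t. gram_defect (?Y t) \<bullet> gram_defect (?Y t)) has_vector_derivative
      gram_defect (?Y 0) \<bullet> ((- 2) *\<^sub>R (?D + ?D ** ?D)) + ((- 2) *\<^sub>R (?D + ?D ** ?D)) \<bullet> gram_defect (?Y 0))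
      (at 0)"
    by (intro bounded_bilinear.has_vector_derivative[OF bounded_bilinear_inner]
        gram_defect_curve_derivative)
  then have "((\<lambda>t. gram_defect (?Y t) \<bullet> gram_defect (?Y t)) has_vector_derivative - 4 * ?q) (at 0)"
    by (simp add: inner_commute)
  then have "((\<lambda>t. M * norm ((dissolve (?Y t) - dissolve (?Y 0)) /\<^sub>R t)
      + \<beta> / 4 * ((gram_defect (?Y t) \<bullet> gram_defect (?Y t) - gram_defect (?Y 0) \<bullet> gram_defect (?Y 0)) /\<^sub>R t))
     \<longlongrightarrow> M * norm (- (15 / 8) *\<^sub>R (X ** ?D ** ?D ** ?D)) + \<beta> / 4 * (- 4 * ?q)) (at_right 0)"
    by (intro tendsto_intros has_vector_derivative_difference_quotient dissolve_curve_derivative)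
  then have "0 \<le> M * norm (- (15 / 8) *\<^sub>R (X ** ?D ** ?D ** ?D)) + \<beta> / 4 * (- 4 * ?q)"
    by (rule tendsto_lowerbound[OF _ ev]) simp
  then have first_order: "\<beta> * ?q \<le> 15 / 8 * (M * norm (X ** ?D ** ?D ** ?D))"
    by simp
  have "\<bar>?D \<bullet> (?D ** ?D)\<bar> \<le> norm ?D * (norm ?D * norm ?D)"
    using Cauchy_Schwarz_ineq2[of ?D "?D ** ?D"] mult_left_mono[OF norm_matrix_mult_le norm_ge_zero]
    by (rule order_trans)
  also have "\<dots> \<le> r * (norm ?D * norm ?D)"
    using D by (intro mult_right_mono) auto
  finally have cubic: "\<bar>?D \<bullet> (?D ** ?D)\<bar> \<le> r * (norm ?D)\<^sup>2"
    by (simp add: power2_eq_square)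
  have q: "?q = (norm ?D)\<^sup>2 + ?D \<bullet> (?D ** ?D)"
    by (simp add: inner_add_right power2_norm_eq_inner)
  have q_lower: "(1 - r) * (norm ?D)\<^sup>2 \<le> ?q"
    using cubic q by (simp add: algebra_simps)
  have "?q \<le> (1 + r) * (norm ?D)\<^sup>2"
    using cubic q by (simp add: algebra_simps)
  \<comment> \<open>The crude constant 4 is a perfect square and yields the factor 2 in the bound on
    \<open>X ** ?D\<close>.\<close>
  also have "\<dots> \<le> 4 * (norm ?D)\<^sup>2"
    using \<open>r < 1 / 2\<close> by (intro mult_right_mono) auto
  finally have "(norm (X ** ?D))\<^sup>2 \<le> (2 * norm ?D)\<^sup>2"
    by (simp add: norm_mult_gram_defect_sq power_mult_distrib)
  then have XD: "norm (X ** ?D) \<le> 2 * norm ?D"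
    by (rule power2_le_imp_le) simp
  have "norm (X ** ?D ** ?D ** ?D) \<le> norm (X ** ?D) * norm ?D * norm ?D"
    using norm_matrix_mult_le[of "X ** ?D ** ?D" ?D]
      mult_right_mono[OF norm_matrix_mult_le[of "X ** ?D" ?D] norm_ge_zero[of ?D]] by linarith
  also have "\<dots> \<le> 2 * norm ?D * norm ?D * r"
    using XD D by (intro mult_mono) auto
  finally have "M * norm (X ** ?D ** ?D ** ?D) \<le> M * (2 * norm ?D * norm ?D * r)"
    using \<open>M \<ge> 0\<close> by (rule mult_left_mono)
  moreover have "\<beta> * ((1 - r) * (norm ?D)\<^sup>2) \<le> \<beta> * ?q"
    using q_lower \<open>\<beta> > 0\<close> by simp
  ultimately have "(\<beta> * (1 - r)) * (norm ?D)\<^sup>2 \<le> (15 / 4 * (r * M)) * (norm ?D)\<^sup>2"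
    using first_order by (simp add: power2_eq_square algebra_simps)
  then have "\<beta> * (1 - r) \<le> 15 / 4 * (r * M)"
    by (rule mult_right_le_imp_le) (use pos in simp)
  \<comment> \<open>The bound on \<open>r\<close> gives
    \<open>\<beta> * (1 - r) > r * \<beta> + 16 * (r * M)\<close>, which exceeds
    \<open>15 / 4 * (r * M)\<close>.\<close>
  then show False
    using rM \<open>r * M \<ge> 0\<close> \<open>r * \<beta> > 0\<close> by (simp add: algebra_simps)
qed

section \<open>From constrained minimizers to minimizers of the penalty function\<close>

lemma dissolve_stiefel: "X \<in> stiefel \<Longrightarrow> dissolve X = X"
  by (simp add: stiefel_iff dissolve_eq isqrt_approx_def)

lemma penalty_fun_stiefel: "X \<in> stiefel \<Longrightarrow> penalty_fun f \<beta> X = f X"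
  by (simp add: penalty_fun_eq dissolve_stiefel stiefel_iff)

lemma local_minimizer_stiefel_imp_penalty:
  fixes X :: "real ^ 'p ^ 'n"
  assumes "locally_lipschitz f" "\<beta> > 0" and min: "local_minimizer_on f stiefel X"
  shows "local_minimizer_on (penalty_fun f \<beta>) UNIV X"
proof -
  from min obtain e where X: "X \<in> stiefel" and "e > 0"
    and e: "\<And>Z. Z \<in> stiefel \<Longrightarrow> dist Z X < e \<Longrightarrow> f X \<le> f Z"
    unfolding local_minimizer_on_def by auto
  from assms(1) obtain \<eta> L where "\<eta> > 0" and lip: "L-lipschitz_on (ball X \<eta>) f"
    unfolding locally_lipschitz_def by blast
  have "L \<ge> 0" by (rule lipschitz_on_nonneg[OF lip])
  define K where "K = 2 * (norm (mat 1 :: real ^ 'p ^ 'p) + 1)"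
  have "K > 0" by (simp add: K_def add_nonneg_pos)
  define m where "m = min e \<eta>"
  \<comment> \<open>The three bounds serve, in order, the cubic defect estimate and the existence of
    a nearby Stiefel point, the requirement that this point lie within \<open>m\<close> of
    \<open>X\<close>, and the domination of the loss in \<open>f\<close> by the penalty.
    \<open>L + 1\<close> keeps the last denominator positive.\<close>
  define \<delta> where "\<delta> = min (1 / 2) (min (m / (2 * K)) (\<beta> / (4 * K * (L + 1))))"
  have "m > 0" "\<delta> > 0"
    using \<open>e > 0\<close> \<open>\<eta> > 0\<close> \<open>K > 0\<close> \<open>L \<ge> 0\<close> \<open>\<beta> > 0\<close> by (simp_all add: m_def \<delta>_def)
  have "(gram_defect \<longlongrightarrow> gram_defect X) (nhds X)" "(dissolve \<longlongrightarrow> dissolve X) (nhds X)"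
    unfolding tendsto_at_iff_tendsto_nhds[symmetric] isCont_def[symmetric]
    by (rule continuous_on_interior[OF continuous_gram_defect]
        continuous_on_interior[OF continuous_dissolve]; simp)+
  then have "eventually (\<lambda>Z. dist (gram_defect Z) (gram_defect X) < \<delta>) (nhds X)"
    "eventually (\<lambda>Z. dist (dissolve Z) (dissolve X) < m / 2) (nhds X)"
    using \<open>\<delta> > 0\<close> \<open>m > 0\<close> by (auto intro: tendstoD simp del: less_divide_eq_numeral1)
  then have "eventually (\<lambda>Z. f X \<le> penalty_fun f \<beta> Z) (nhds X)"
  proof eventually_elim
    case (elim Z)
    let ?d = "norm (gram_defect Z)"
    have d: "?d < \<delta>" and AX: "norm (dissolve Z - X) < m / 2"
      using elim X by (simp_all add: stiefel_iff dissolve_stiefel dist_norm)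
    have "?d \<le> 1 / 2" "K * ?d < m / 2"
      using d \<open>K > 0\<close> unfolding \<delta>_def by (simp_all add: field_simps)
    have "?d * (4 * K * (L + 1)) < \<beta>"
      using d \<open>K > 0\<close> \<open>L \<ge> 0\<close> unfolding \<delta>_def by (subst pos_less_divide_eq[symmetric]) auto
    then have "4 * (L + 1) * (K * ?d) \<le> \<beta>" by (simp add: mult_ac)
    have "norm (gram_defect (dissolve Z)) \<le> ?d ^ 3"
      using \<open>?d \<le> 1 / 2\<close> by (intro norm_gram_defect_dissolve_le) simp
    moreover have "?d ^ 3 \<le> ?d ^ 1"
      using \<open>?d \<le> 1 / 2\<close> by (intro power_decreasing) auto
    ultimately have small: "norm (gram_defect (dissolve Z)) \<le> 1 / 2"
      using \<open>?d \<le> 1 / 2\<close> by simp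
    \<comment> \<open>The Stiefel point is taken near \<open>dissolve Z\<close> and not near
      \<open>Z\<close>: the distance is then cubic in the defect of \<open>Z\<close>, and so of
      smaller order than the quadratic penalty.\<close>
    obtain P where P: "P \<in> stiefel" "norm (P - dissolve Z) \<le> K * norm (gram_defect (dissolve Z))"
      using stiefel_point_near[OF small] unfolding K_def by blast
    have "K * norm (gram_defect (dissolve Z)) \<le> K * ?d ^ 3"
      using \<open>norm (gram_defect (dissolve Z)) \<le> ?d ^ 3\<close> \<open>K > 0\<close> by simp
    with P have PZ: "norm (P - dissolve Z) \<le> K * ?d ^ 3" by linarith
    have "K * ?d ^ 3 \<le> K * ?d" using \<open>?d ^ 3 \<le> ?d ^ 1\<close> \<open>K > 0\<close> by simp
    then have "norm (P - X) < m"
      using PZ AX \<open>K * ?d < m / 2\<close> norm_triangle_ineq[of "P - dissolve Z" "dissolve Z - X"] by simp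
    then have "f X \<le> f P"
      using P by (intro e) (auto simp: m_def dist_norm)
    moreover have "\<bar>f P - f (dissolve Z)\<bar> \<le> L * norm (P - dissolve Z)"
      using lipschitz_onD[OF lip, of P "dissolve Z"] \<open>norm (P - X) < m\<close> AX \<open>m > 0\<close>
      by (simp add: m_def dist_norm norm_minus_commute)
    moreover have "L * norm (P - dissolve Z) \<le> \<beta> / 4 * ?d\<^sup>2"
    proof -
      have "L * norm (P - dissolve Z) \<le> (L + 1) * (K * ?d ^ 3)"
        using PZ \<open>L \<ge> 0\<close> by (intro mult_mono) auto
      also have "\<dots> = (L + 1) * (K * ?d) * ?d\<^sup>2"
        by (simp add: eval_nat_numeral)
      also have "\<dots> \<le> \<beta> / 4 * ?d\<^sup>2"
        using \<open>4 * (L + 1) * (K * ?d) \<le> \<beta>\<close> by (intro mult_right_mono) (auto simp: algebra_simps)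
      finally show ?thesis .
    qed
    ultimately show ?case
      unfolding penalty_fun_eq by linarith
  qed
  then show ?thesis
    using X by (auto simp: local_minimizer_on_def eventually_nhds_metric penalty_fun_stiefel)
qed

theorem theorem3p14:
  fixes f :: "real ^ 'p ^ 'n \<Rightarrow> real" and \<beta> r :: real
  assumes "locally_lipschitz f"
    and "\<beta> > 0"
    and "0 < r" and "ennreal r < ennreal \<beta> / (2 * ennreal \<beta> + 16 * M1 f)"
  shows "(\<forall>X\<in>Omega r. local_minimizer_on (penalty_fun f \<beta>) UNIV X \<longrightarrow>
            local_minimizer_on f stiefel X) \<and>
         (\<forall>X. local_minimizer_on f stiefel X \<longrightarrow>
            local_minimizer_on (penalty_fun f \<beta>) UNIV X)"
proof (intro conjI ballI allI impI)
  fix X :: "real ^ 'p ^ 'n"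
  assume X: "X \<in> Omega r" and min: "local_minimizer_on (penalty_fun f \<beta>) UNIV X"
  \<comment> \<open>An infinite \<open>M1 f\<close> would make the bound on \<open>r\<close> equal
    to 0 in \<open>ennreal\<close>, and nothing lies strictly below 0.\<close>
  have "M1 f \<noteq> top"
    using assms(4) by (auto simp: ennreal_mult_top)
  then obtain M where M: "M \<ge> 0" "M1 f = ennreal M"
    by (metis ennreal_cases infinity_ennreal_def)
  have "ennreal \<beta> / (2 * ennreal \<beta> + 16 * M1 f) = ennreal (\<beta> / (2 * \<beta> + 16 * M))"
    using M \<open>\<beta> > 0\<close> by (simp add: divide_ennreal[symmetric] ennreal_plus ennreal_mult)
  then have "r < \<beta> / (2 * \<beta> + 16 * M)"
    using assms by (simp add: ennreal_less_iff)
  moreover have "2 * \<beta> + 16 * M > 0" using M \<open>\<beta> > 0\<close> by simp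
  ultimately have r: "r * (2 * \<beta> + 16 * M) < \<beta>" by (simp add: pos_less_divide_eq)
  moreover have "0 \<le> r * M" using M \<open>0 < r\<close> by simp
  ultimately have "r * (2 * \<beta>) < 1 * \<beta>" by (simp add: algebra_simps)
  then have "r < 1" using \<open>\<beta> > 0\<close> \<open>0 < r\<close> by simp
  have D: "norm (gram_defect X) \<le> r" using X by (simp add: Omega_iff)
  have bound: "norm W \<le> M" if "Y \<in> Omega 1" "W \<in> clarke_subdifferential f Y" for Y W
  proof -
    have "ennreal (norm W) \<le> M1 f"
      unfolding M1_def using that by (intro Sup_upper) blast
    then show ?thesis using M by simp
  qed
  \<comment> \<open>Places \<open>dissolve X\<close> in the open set of defect less than 1, so that
    a whole ball around it lies in \<open>Omega 1\<close>, where \<open>M\<close> bounds all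
    subgradients.\<close>
  have "norm (gram_defect (dissolve X)) \<le> norm (gram_defect X) ^ 3"
    using D \<open>r < 1\<close> by (intro norm_gram_defect_dissolve_le) simp
  also have "\<dots> \<le> norm (gram_defect X) ^ 1"
    using D \<open>r < 1\<close> by (intro power_decreasing) auto
  finally have "norm (gram_defect (dissolve X)) < 1" using D \<open>r < 1\<close> by simp
  moreover have "open {Y :: real ^ 'p ^ 'n. norm (gram_defect Y) < 1}"
    by (intro open_Collect_less continuous_intros continuous_gram_defect)
  ultimately obtain e where "e > 0" and "ball (dissolve X) e \<subseteq> {Y. norm (gram_defect Y) < 1}"
    unfolding open_contains_ball by blast
  then have "ball (dissolve X) e \<subseteq> Omega 1" by (force simp: Omega_iff)
  then have "M-lipschitz_on (ball (dissolve X) e) f"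
    using bound M by (intro lipschitz_on_clarke_bound assms(1)) auto
  then have "X \<in> stiefel"
    using local_minimizer_penalty_feasible[OF min D] \<open>e > 0\<close> assms r by blast
  \<comment> \<open>On the Stiefel manifold \<open>penalty_fun\<close> coincides with
    \<open>f\<close>, so unconstrained minimality restricts to it.\<close>
  then show "local_minimizer_on f stiefel X"
    using min unfolding local_minimizer_on_def by (metis UNIV_I penalty_fun_stiefel)
next
  fix X :: "real ^ 'p ^ 'n"
  assume "local_minimizer_on f stiefel X"
  then show "local_minimizer_on (penalty_fun f \<beta>) UNIV X"
    using local_minimizer_stiefel_imp_penalty assms by blast
qed

end
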